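(* Let $k \ge 1$ be an integer and let $G$ be a $(k+1)$-connected graph of order $n$ that is fractional $k$-factor-critical, with minimum degree $\delta$, where $n \equiv k \pmod{2}$ and \[ n \ge \max\left\{6\delta-5k+8,~ \frac{\delta^2}{6}-\left(\frac{k}{3}-\frac{3}{2}\right)\delta+\frac{k^2}{6}-\frac{k}{2}+4\right\}. \] If \[ |E(G)| \ge |E(K_\delta \vee (K_{n-2\delta + k-3} \cup K_3 \cup (\delta-k)K_1))|, \] then $G$ is $k$-factor-critical unless $G \cong K_\delta \vee (K_{n-2\delta + k-3} \cup K_3 \cup (\delta-k)K_1)$.
   Context: All graphs are finite, simple and undirected. $K_m$ is the complete graph on $m$ vertices; $G_1\cup G_2$ is the disjoint union; $G_1\vee G_2$ (join) is obtained from $G_1\cup G_2$ by adding all edges between $V(G_1)$ and $V(G_2)$; $aH$ denotes the disjoint union of $a$ copies of $H$. A graph of order $n$ is $t$-connected if $n>t$ and $G-X$ is connected for every $X\subseteq V(G)$ with $|X|<t$. A graph $G$ of order $n$ is $k$-factor-critical (for $0\le k<n$) if for every set of $k$ vertices, deleting them leaves a graph with a perfect matching. A fractional perfect matching of $G$ is a function $h:E(G)\to[0,1]$ with $\sum_{e\ni v} h(e)=1$ for every vertex $v$; $G$ is fractional $k$-factor-critical if deleting any $k$ vertices leaves a graph having a fractional perfect matching. *)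

theory Defs
  imports Complex_Main "HOL-Number_Theory.Cong"
begin

record 'a graph =
  verts :: "'a set"
  edges :: "'a set set"

definition simple_graph :: "'a graph \<Rightarrow> bool" where
  "simple_graph G \<longleftrightarrow>
     finite (verts G) \<and> (\<forall>e\<in>edges G. e \<subseteq> verts G \<and> card e = 2)"

definition graph_order :: "'a graph \<Rightarrow> nat" where
  "graph_order G = card (verts G)"

definition degree :: "'a graph \<Rightarrow> 'a \<Rightarrow> nat" where
  "degree G v = card {e \<in> edges G. v \<in> e}"

definition min_degree :: "'a graph \<Rightarrow> nat" where
  "min_degree G = Min (degree G ` verts G)"

definition delete_verts :: "'a graph \<Rightarrow> 'a set \<Rightarrow> 'a graph" where
  "delete_verts G X = \<lparr>verts = verts G - X, edges = {e \<in> edges G. e \<inter> X = {}}\<rparr>"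

definition graph_iso :: "'a graph \<Rightarrow> 'b graph \<Rightarrow> bool" where
  "graph_iso G H \<longleftrightarrow>
     (\<exists>f. bij_betw f (verts G) (verts H) \<and>
          (\<forall>u\<in>verts G. \<forall>v\<in>verts G. {u, v} \<in> edges G \<longleftrightarrow> {f u, f v} \<in> edges H))"

definition complete_graph :: "nat \<Rightarrow> nat graph" where
  "complete_graph m = \<lparr>verts = {..<m}, edges = {{u, v} | u v. u < m \<and> v < m \<and> u \<noteq> v}\<rparr>"

definition graph_union :: "'a graph \<Rightarrow> 'b graph \<Rightarrow> ('a + 'b) graph" where
  "graph_union G H =
     \<lparr>verts = verts G <+> verts H,
      edges = (\<lambda>e. Inl ` e) ` edges G \<union> (\<lambda>e. Inr ` e) ` edges H\<rparr>"

definition graph_join :: "'a graph \<Rightarrow> 'b graph \<Rightarrow> ('a + 'b) graph" where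
  "graph_join G H =
     \<lparr>verts = verts (graph_union G H),
      edges = edges (graph_union G H) \<union>
              {{Inl u, Inr v} | u v. u \<in> verts G \<and> v \<in> verts H}\<rparr>"

definition graph_copies :: "nat \<Rightarrow> 'a graph \<Rightarrow> (nat \<times> 'a) graph" where
  "graph_copies a H =
     \<lparr>verts = {..<a} \<times> verts H,
      edges = {Pair i ` e | i e. i < a \<and> e \<in> edges H}\<rparr>"

definition connected_graph :: "'a graph \<Rightarrow> bool" where
  "connected_graph G \<longleftrightarrow>
     verts G \<noteq> {} \<and>
     (\<forall>u\<in>verts G. \<forall>v\<in>verts G. (u, v) \<in> {(x, y). {x, y} \<in> edges G}\<^sup>*)"

definition t_connected :: "nat \<Rightarrow> 'a graph \<Rightarrow> bool" where
  "t_connected t G \<longleftrightarrow>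
     graph_order G > t \<and>
     (\<forall>X. X \<subseteq> verts G \<and> card X < t \<longrightarrow> connected_graph (delete_verts G X))"

definition perfect_matching :: "'a graph \<Rightarrow> 'a set set \<Rightarrow> bool" where
  "perfect_matching G M \<longleftrightarrow> M \<subseteq> edges G \<and> (\<forall>v\<in>verts G. \<exists>!e. e \<in> M \<and> v \<in> e)"

definition fractional_perfect_matching :: "'a graph \<Rightarrow> ('a set \<Rightarrow> real) \<Rightarrow> bool" where
  "fractional_perfect_matching G h \<longleftrightarrow>
     (\<forall>e\<in>edges G. 0 \<le> h e \<and> h e \<le> 1) \<and>
     (\<forall>v\<in>verts G. (\<Sum>e\<in>{e \<in> edges G. v \<in> e}. h e) = 1)"

definition factor_critical :: "nat \<Rightarrow> 'a graph \<Rightarrow> bool" where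
  "factor_critical k G \<longleftrightarrow>
     k < graph_order G \<and>
     (\<forall>X. X \<subseteq> verts G \<and> card X = k \<longrightarrow> (\<exists>M. perfect_matching (delete_verts G X) M))"

definition fractional_factor_critical :: "nat \<Rightarrow> 'a graph \<Rightarrow> bool" where
  "fractional_factor_critical k G \<longleftrightarrow>
     (\<forall>X. X \<subseteq> verts G \<and> card X = k \<longrightarrow>
          (\<exists>h. fractional_perfect_matching (delete_verts G X) h))"

text \<open>
  The graph \<open>K\<^sub>\<delta> \<or> (K\<^bsub>n-2\<delta>+k-3\<^esub> \<union> K\<^sub>3 \<union> (\<delta>-k)K\<^sub>1)\<close>. The clique order is written
  \<open>n + k - (2 * \<delta> + 3)\<close> because \<open>n - 2 * \<delta>\<close> may be negative, so that truncated subtraction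
  in the other order would be wrong; the construction is meant for \<open>\<delta> \<ge> k\<close> and
  \<open>n + k \<ge> 2 * \<delta> + 3\<close>.
\<close>
definition extremal_graph ::
  "nat \<Rightarrow> nat \<Rightarrow> nat \<Rightarrow> (nat + ((nat + nat) + (nat \<times> nat))) graph" where
  "extremal_graph n \<delta> k =
     graph_join (complete_graph \<delta>)
       (graph_union
         (graph_union (complete_graph (n + k - (2 * \<delta> + 3))) (complete_graph 3))
         (graph_copies (\<delta> - k) (complete_graph 1)))"

end

theory Submission
  imports Defs "HOL-Library.Disjoint_Sets"
begin

text \<open>
  If \<open>G\<close> is not \<open>k\<close>-factor-critical, Tutte's theorem and parity give a set \<open>S\<close> of \<open>k + t\<close> vertices
  and a partition of the remaining vertices into \<open>t + 2\<close> odd parts with no edges between them.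
  Connectivity forces \<open>t \<ge> 1\<close>, and the fractional matchings force at most \<open>t\<close> parts to be
  singletons, so two parts have at least three vertices. Hence \<open>2 * |E(G)|\<close> is at most
  \<open>n\<^sup>2 - n - (n - |S|)\<^sup>2\<close> plus the sum of the squares of the part sizes, which is largest when
  all surplus vertices lie in one part.

  Put \<open>N = n - k\<close> and \<open>d = \<delta> - k\<close>. If \<open>t < d\<close>, the minimum degree makes every part have at least
  \<open>max 3 (d - t + 1)\<close> vertices, and there are too few edges. If \<open>t \<ge> d\<close>, the bound is at most the
  size of the extremal graph because \<open>N \<ge> 6 * d + 8\<close>. For \<open>N = 6 * d + 8\<close> equality also occurs at
  \<open>t = 3 * d + 1\<close>, but equality makes \<open>G\<close> contain every edge that the partition allows, so \<open>\<delta> \<ge> |S|\<close> and \<open>t = d\<close>.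
\<close>

subsection \<open>Hall and Tutte\<close>

text \<open>Strong induction on \<open>I\<close>. If some nonempty proper subfamily \<open>J\<close>
  is tight, it is matched inside its union \<open>U\<close> and the other indices outside
  \<open>U\<close>. Otherwise every nonempty proper subfamily has one value to spare, so any index
  may take any of its values, which is then removed.\<close>

lemma hall_marriage:
  assumes "finite I" and "\<And>i. i \<in> I \<Longrightarrow> finite (N i)"
    and "\<And>J. J \<subseteq> I \<Longrightarrow> card J \<le> card (\<Union>(N ` J))"
  shows "\<exists>f. inj_on f I \<and> (\<forall>i\<in>I. f i \<in> N i)"
  using assms
proof (induction I arbitrary: N rule: finite_psubset_induct)
  case (psubset I)
  note fin = psubset.prems(1) and hall = psubset.prems(2)
  consider "I = {}"
    | J where "J \<subset> I" "J \<noteq> {}" "card (\<Union>(N ` J)) \<le> card J"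
    | "I \<noteq> {}" "\<And>J. J \<subset> I \<Longrightarrow> J \<noteq> {} \<Longrightarrow> card J < card (\<Union>(N ` J))"
    by (meson not_le)
  then show ?case
  proof cases
    case 1
    then show ?thesis by simp
  next
    case (2 J)
    define U where "U = \<Union>(N ` J)"
    have finJ: "finite J" using 2(1) psubset.hyps finite_subset by blast
    have finU: "finite U" unfolding U_def using finJ fin 2(1) by blast
    have cardU: "card U = card J" using 2 hall[of J] unfolding U_def by force
    obtain f where f: "inj_on f J" "\<forall>i\<in>J. f i \<in> N i"
      using psubset.IH[OF 2(1), of N] fin hall 2(1) by (meson psubset_imp_subset subset_trans subsetD)
    have "\<exists>g. inj_on g (I - J) \<and> (\<forall>i\<in>I - J. g i \<in> N i - U)"
    proof (rule psubset.IH)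
      show "I - J \<subset> I" using 2 by blast
      show "finite (N i - U)" if "i \<in> I - J" for i using fin that by blast
      show "card K \<le> card (\<Union>i\<in>K. N i - U)" if K: "K \<subseteq> I - J" for K
      proof -
        have finK: "finite K" using K psubset.hyps finite_subset by blast
        have fK: "finite (\<Union>i\<in>K. N i - U)" using finK fin K by blast
        have "card J + card K = card (J \<union> K)"
          using K finJ finK by (subst card_Un_disjoint) auto
        \<comment> \<open>Hall's condition for \<open>J \<union> K\<close>, less the
          \<open>card J = card U\<close> values used up by the tight family, is Hall's condition for
          \<open>K\<close> outside \<open>U\<close>.\<close>
        also have "\<dots> \<le> card (\<Union>(N ` (J \<union> K)))" using K 2(1) by (intro hall) blast
        also have "\<Union>(N ` (J \<union> K)) = U \<union> (\<Union>i\<in>K. N i - U)" unfolding U_def by blast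
        also have "card \<dots> = card U + card (\<Union>i\<in>K. N i - U)"
          using finU fK by (intro card_Un_disjoint) auto
        finally show ?thesis using cardU by simp
      qed
    qed
    then obtain g where g: "inj_on g (I - J)" "\<forall>i\<in>I - J. g i \<in> N i - U" by blast
    let ?h = "\<lambda>i. if i \<in> J then f i else g i"
    have fU: "f i \<in> U" if "i \<in> J" for i using f(2) that unfolding U_def by blast
    have "inj_on ?h I"
    proof (rule inj_onI)
      fix x y assume xy: "x \<in> I" "y \<in> I" "?h x = ?h y"
      then show "x = y"
        using inj_onD[OF f(1), of x y] inj_onD[OF g(1), of x y] g(2) fU
        by (cases "x \<in> J"; cases "y \<in> J") (simp_all, metis DiffE DiffI, metis DiffE DiffI)
    qed
    moreover have "\<forall>i\<in>I. ?h i \<in> N i" using f(2) g(2) by auto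
    ultimately show ?thesis by blast
  next
    case 3
    then obtain i where i: "i \<in> I" by blast
    have "card {i} \<le> card (\<Union>(N ` {i}))" using i by (intro hall) blast
    then have "N i \<noteq> {}" by auto
    then obtain x where x: "x \<in> N i" by blast
    have "\<exists>g. inj_on g (I - {i}) \<and> (\<forall>j\<in>I - {i}. g j \<in> N j - {x})"
    proof (rule psubset.IH)
      show "I - {i} \<subset> I" using i by blast
      show "finite (N j - {x})" if "j \<in> I - {i}" for j using fin that by blast
      show "card K \<le> card (\<Union>j\<in>K. N j - {x})" if K: "K \<subseteq> I - {i}" for K
      proof (cases "K = {}")
        case False
        have "K \<subset> I" using K i by blast
        then have "card K < card (\<Union>(N ` K))" using 3(2) False by blast
        moreover have "(\<Union>j\<in>K. N j - {x}) = \<Union>(N ` K) - {x}" by blast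
        ultimately show ?thesis by (auto simp: card_Diff_singleton_if)
      qed simp
    qed
    then obtain g where g: "inj_on g (I - {i})" "\<forall>j\<in>I - {i}. g j \<in> N j - {x}" by blast
    have "inj_on (g(i := x)) I"
    proof (rule inj_onI)
      fix a b assume "a \<in> I" "b \<in> I" "(g(i := x)) a = (g(i := x)) b"
      then show "a = b"
        using inj_onD[OF g(1), of a b] g(2) by (cases "a = i"; cases "b = i") auto
    qed
    moreover have "\<forall>j\<in>I. (g(i := x)) j \<in> N j" using g(2) x by auto
    ultimately show ?thesis by blast
  qed
qed

section \<open>Closed sets, odd families and parity\<close>

text \<open>When \<open>E\<close> consists of 2-sets, such an \<open>A\<close> is a union of
  components of the subgraph induced on \<open>U\<close>. Allowing unions avoids constructing
  components.\<close>

definition closed_in :: "'a set set \<Rightarrow> 'a set \<Rightarrow> 'a set \<Rightarrow> bool" where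
  "closed_in E U A \<longleftrightarrow> A \<subseteq> U \<and> (\<forall>e\<in>E. e \<subseteq> U \<longrightarrow> e \<inter> A \<noteq> {} \<longrightarrow> e \<subseteq> A)"

text \<open>Stands in for the odd components in Tutte's condition. Oddness also makes every member
  finite and nonempty, since \<open>card\<close> is 0 on infinite sets. The family may leave part of
  \<open>U\<close> uncovered.\<close>

definition odd_family :: "'a set set \<Rightarrow> 'a set \<Rightarrow> 'a set set \<Rightarrow> bool" where
  "odd_family E U P \<longleftrightarrow> disjoint P \<and> (\<forall>A\<in>P. odd (card A) \<and> closed_in E U A)"

text \<open>A perfect matching of the subgraph induced on \<open>V\<close>. Keeping \<open>E\<close>
  fixed lets the induction for Tutte's theorem shrink only the vertex set.\<close>

definition matchable :: "'a set set \<Rightarrow> 'a set \<Rightarrow> bool" where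
  "matchable E V \<longleftrightarrow> (\<exists>M\<subseteq>E. (\<forall>e\<in>M. e \<subseteq> V) \<and> (\<forall>v\<in>V. \<exists>!e. e \<in> M \<and> v \<in> e))"

lemma closed_inD: "closed_in E U A \<Longrightarrow> e \<in> E \<Longrightarrow> e \<subseteq> U \<Longrightarrow> e \<inter> A \<noteq> {} \<Longrightarrow> e \<subseteq> A"
  unfolding closed_in_def by blast

lemma closed_in_mono: "closed_in E U A \<Longrightarrow> A \<subseteq> U' \<Longrightarrow> U' \<subseteq> U \<Longrightarrow> closed_in E U' A"
  unfolding closed_in_def by blast

lemma closed_in_rest:
  assumes "\<And>A. A \<in> P \<Longrightarrow> closed_in E U A"
  shows "closed_in E U (U - \<Union>P)"
  using assms unfolding closed_in_def by blast

lemma odd_family_subset: "odd_family E U P \<Longrightarrow> Q \<subseteq> P \<Longrightarrow> odd_family E U Q"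
  unfolding odd_family_def by (meson disjoint_def pairwise_subset subsetD)

lemma odd_family_Union: "odd_family E U P \<Longrightarrow> \<Union>P \<subseteq> U"
  unfolding odd_family_def closed_in_def by blast

lemma odd_family_finite: "odd_family E U P \<Longrightarrow> finite U \<Longrightarrow> finite P"
  by (meson Sup_le_iff finite_UnionD finite_subset odd_family_Union)

text \<open>The complement of a union of closed sets is closed. If it is odd it is nonempty, so it
  differs from all members, which it does not meet.\<close>

lemma odd_family_insert_rest:
  assumes "odd_family E U P" "odd (card (U - \<Union>P))"
  shows "odd_family E U (insert (U - \<Union>P) P)" and "U - \<Union>P \<notin> P"
proof -
  have "U - \<Union>P \<noteq> {}" using assms(2) by force
  then show "U - \<Union>P \<notin> P" by blast
  show "odd_family E U (insert (U - \<Union>P) P)"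
    using assms closed_in_rest[of P E U] unfolding odd_family_def
    by (auto simp: disjoint_def)
qed

text \<open>A disjoint union of odd sets has the parity of their number; then compare with
  \<open>card V = card S + card (\<Union>P) + card (V - S - \<Union>P)\<close>.\<close>

lemma odd_family_parity:
  assumes "finite V" "S \<subseteq> V" "odd_family E (V - S) P" "even (card V)"
  shows "even (card (V - S - \<Union>P)) \<longleftrightarrow> even (card S + card P)"
proof -
  have finA: "finite A" if "A \<in> P" for A
    using assms(3) that by (metis card.infinite even_zero odd_family_def)
  have "card (\<Union>P) = (\<Sum>A\<in>P. card A)"
    using assms(3) finA by (intro card_Union_disjoint) (auto simp: odd_family_def)
  moreover have "even (\<Sum>A\<in>P. card A) \<longleftrightarrow> even (card {A \<in> P. odd (card A)})"
    using odd_family_finite[OF assms(3)] assms(1) by (subst even_sum_iff) auto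
  moreover have "{A \<in> P. odd (card A)} = P" using assms(3) unfolding odd_family_def by blast
  ultimately have U: "even (card (\<Union>P)) \<longleftrightarrow> even (card P)" by simp
  have sub: "\<Union>P \<subseteq> V - S" using odd_family_Union[OF assms(3)] .
  have fin: "finite S" "finite (\<Union>P)" using assms(1,2) sub by (meson finite_Diff finite_subset)+
  have "card (V - S - \<Union>P) = card (V - S) - card (\<Union>P)"
    using sub fin by (intro card_Diff_subset)
  moreover have "card (V - S) = card V - card S"
    using assms(2) fin by (intro card_Diff_subset)
  moreover have "card (\<Union>P) \<le> card (V - S)" "card S \<le> card V"
    using sub assms(1,2) by (auto intro: card_mono)
  ultimately have "card V = card S + card (\<Union>P) + card (V - S - \<Union>P)" by linarith
  then show ?thesis using U assms(4) by simp
qed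

text \<open>Keep only \<open>card S + 1\<close> members. The discarded ones fall into the rest,
  which parity makes odd, so the rest itself serves as the last member and the family becomes a
  partition.\<close>

lemma odd_family_saturate:
  assumes "finite V" "even (card V)" "S \<subseteq> V" "odd_family E (V - S) P" "card S < card P"
  shows "\<exists>Q. odd_family E (V - S) Q \<and> card Q = card S + 2 \<and> \<Union>Q = V - S"
proof -
  obtain Q where Q: "Q \<subseteq> P" "card Q = Suc (card S)"
    using assms(5) by (meson Suc_leI obtain_subset_with_card_n)
  have oQ: "odd_family E (V - S) Q" using odd_family_subset[OF assms(4) Q(1)] .
  have fQ: "finite Q" using Q(2) card_ge_0_finite by force
  have sub: "\<Union>Q \<subseteq> V - S" using odd_family_Union[OF oQ] .
  have odd: "odd (card (V - S - \<Union>Q))"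
    using odd_family_parity[OF assms(1,3) oQ assms(2)] Q(2) by simp
  let ?Q = "insert (V - S - \<Union>Q) Q"
  have "card ?Q = card S + 2"
    using odd_family_insert_rest(2)[OF oQ odd] fQ Q(2) by simp
  moreover have "\<Union>?Q = V - S" using sub by blast
  ultimately show ?thesis using odd_family_insert_rest(1)[OF oQ odd] by blast
qed

section \<open>Gluing matchings, and Tutte's theorem\<close>

lemma matchable_empty: "matchable E {}"
  unfolding matchable_def by blast

lemma matchable_edge: "{x, y} \<in> E \<Longrightarrow> matchable E {x, y}"
  unfolding matchable_def by (rule exI[of _ "{{x, y}}"]) auto

lemma matchable_Un:
  assumes "matchable E A" "matchable E B" "A \<inter> B = {}"
  shows "matchable E (A \<union> B)"
proof -
  obtain M N where M: "M \<subseteq> E" "\<forall>e\<in>M. e \<subseteq> A" "\<forall>v\<in>A. \<exists>!e. e \<in> M \<and> v \<in> e"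
    and N: "N \<subseteq> E" "\<forall>e\<in>N. e \<subseteq> B" "\<forall>v\<in>B. \<exists>!e. e \<in> N \<and> v \<in> e"
    using assms(1,2) unfolding matchable_def by (elim exE conjE) rule
  have "\<exists>!e. e \<in> M \<union> N \<and> v \<in> e" if "v \<in> A \<union> B" for v
  proof (cases "v \<in> A")
    case True
    then have "v \<notin> e" if "e \<in> N" for e using N(2) that assms(3) by blast
    then show ?thesis using M(3) True by (metis Un_iff)
  next
    case False
    then have "v \<notin> e" if "e \<in> M" for e using M(2) that by blast
    then show ?thesis using N(3) False that by (metis Un_iff)
  qed
  then have "\<forall>v\<in>A \<union> B. \<exists>!e. e \<in> M \<union> N \<and> v \<in> e" by (rule ballI)
  moreover have "M \<union> N \<subseteq> E" "\<forall>e\<in>M \<union> N. e \<subseteq> A \<union> B" using M(1,2) N(1,2) by auto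
  ultimately show ?thesis unfolding matchable_def by (intro exI[of _ "M \<union> N"] conjI)
qed

lemma matchable_UN:
  assumes "finite I" "\<And>i. i \<in> I \<Longrightarrow> matchable E (A i)"
    and "\<And>i j. i \<in> I \<Longrightarrow> j \<in> I \<Longrightarrow> i \<noteq> j \<Longrightarrow> A i \<inter> A j = {}"
  shows "matchable E (\<Union>i\<in>I. A i)"
  using assms
proof (induction I rule: finite_induct)
  case (insert i I)
  have "A i \<inter> (\<Union>j\<in>I. A j) = {}" using insert.prems(2)[of i] insert.hyps(2) by fastforce
  then show ?case using matchable_Un[of E "A i"] insert by simp
qed (simp add: matchable_empty)

text \<open>
  Anderson's proof, with arbitrary odd closed sets in place of odd components. For a largest \<open>S\<close>
  attaining equality, Hall's theorem matches \<open>S\<close> with the family, and maximality of \<open>S\<close> makes every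
  member minus one vertex inherit the hypothesis.
\<close>
theorem tutte_matchable:
  assumes "finite V" and "\<And>e. e \<in> E \<Longrightarrow> card e = 2"
    and "\<And>S P. S \<subseteq> V \<Longrightarrow> odd_family E (V - S) P \<Longrightarrow> card P \<le> card S"
  shows "matchable E V"
  using assms(1,3)
proof (induction V rule: finite_psubset_induct)
  case (psubset V)
  note finV = psubset.hyps and tutte = psubset.prems
  define good where "good S \<longleftrightarrow> S \<subseteq> V \<and> (\<exists>P. odd_family E (V - S) P \<and> card P = card S)" for S
  have evenV: "even (card V)"
  proof (rule ccontr)
    assume "odd (card V)"
    then have "odd_family E (V - {}) {V}"
      unfolding odd_family_def closed_in_def by (auto simp: disjoint_def)
    then show False using tutte[of "{}" "{V}"] by simp
  qed
  have "good {}" unfolding good_def odd_family_def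
    by (intro conjI exI[of _ "{}"]) (simp_all add: disjoint_def)
  moreover have "\<forall>S. good S \<longrightarrow> card S < Suc (card V)"
    unfolding good_def using finV by (auto simp: card_mono less_Suc_eq_le)
  ultimately have "\<exists>S. good S \<and> (\<forall>T. good T \<longrightarrow> card T \<le> card S)"
    by (rule Lattices_Big.ex_has_greatest_nat)
  then obtain S where S: "good S" "\<And>T. good T \<Longrightarrow> card T \<le> card S" by auto
  then obtain P where SV: "S \<subseteq> V" and P: "odd_family E (V - S) P" "card P = card S"
    unfolding good_def by blast
  have finS: "finite S" using SV finV finite_subset by blast
  have finP: "finite P" using odd_family_finite[OF P(1)] finV by simp
  have subP: "\<Union>P \<subseteq> V - S" using odd_family_Union[OF P(1)] .
  have disjP: "A \<inter> B = {}" if "A \<in> P" "B \<in> P" "A \<noteq> B" for A B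
    using P(1) that unfolding odd_family_def disjoint_def by blast
  \<comment> \<open>By parity the uncovered rest is even. Moving an uncovered vertex
    \<open>v\<close> into \<open>S\<close> makes it odd, so it joins \<open>P\<close>, and
    \<open>insert v S\<close> is a larger set attaining equality.\<close>
  have UP: "\<Union>P = V - S"
  proof (rule ccontr)
    assume "\<Union>P \<noteq> V - S"
    then obtain v where v: "v \<in> V - S - \<Union>P" using subP by blast
    have "even (card (V - S - \<Union>P))"
      using odd_family_parity[OF finV SV P(1) evenV] P(2) by simp
    moreover have "card (V - S - \<Union>P) > 0" using v finV card_gt_0_iff by blast
    moreover have eq: "V - insert v S - \<Union>P = V - S - \<Union>P - {v}" by blast
    ultimately have odd: "odd (card (V - insert v S - \<Union>P))" using v by simp
    have o: "odd_family E (V - insert v S) P"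
      using P(1) subP v unfolding odd_family_def
      by (meson DiffE Diff_mono UnionI Union_upper closed_in_def closed_in_mono insert_iff subset_Diff_insert subset_insertI subset_refl)
    have "card (insert (V - insert v S - \<Union>P) P) = card (insert v S)"
      using odd_family_insert_rest(2)[OF o odd] finP finS v P(2) by simp
    then have "good (insert v S)" unfolding good_def
      using odd_family_insert_rest(1)[OF o odd] v SV by blast
    then show False using S(2)[of "insert v S"] v finS by simp
  qed
  \<comment> \<open>\<open>C - {v}\<close> is even, so a violation at \<open>T\<close> saturates to
    \<open>card T + 2\<close> odd sets. Replacing \<open>C\<close> by them and adding
    \<open>v\<close> and \<open>T\<close> to \<open>S\<close> raises both sides by
    \<open>card T + 1\<close>, which contradicts the maximality of \<open>S\<close>.\<close>
  have match: "matchable E (C - {v})" if C: "C \<in> P" and v: "v \<in> C" for C v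
  proof (rule psubset.IH)
    show "C - {v} \<subset> V" using C v subP by blast
    fix T Q assume T: "T \<subseteq> C - {v}" and Q: "odd_family E (C - {v} - T) Q"
    show "card Q \<le> card T"
    proof (rule ccontr)
      assume "\<not> card Q \<le> card T"
      moreover have finC: "finite C" using C subP finV by (meson Union_upper finite_Diff finite_subset subset_trans)
      moreover have "odd (card C)" and clC: "closed_in E (V - S) C"
        using C P(1) unfolding odd_family_def by auto
      ultimately obtain R where R: "odd_family E (C - {v} - T) R" "card R = card T + 2"
        using odd_family_saturate[of "C - {v}" T E Q] T Q v by auto
      let ?S = "S \<union> insert v T"
      let ?P = "(P - {C}) \<union> R"
      have finT: "finite T" using T finC finite_subset by blast
      have finR: "finite R" using R(2) card_ge_0_finite by force
      have subR: "\<Union>R \<subseteq> C - {v} - T" using odd_family_Union[OF R(1)] .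
      have neR: "A \<noteq> {}" if "A \<in> R" for A using R(1) that unfolding odd_family_def by force
      have "(P - {C}) \<inter> R = {}" using subR neR disjP[OF _ C] by blast
      then have "card ?P = card P - 1 + (card T + 2)"
        using finP finR C R(2) by (simp add: card_Un_disjoint)
      moreover have "card P > 0" using C finP card_gt_0_iff by blast
      moreover have "card ?S = card S + Suc (card T)"
        using finS finT T C v subP by (subst card_Un_disjoint) (auto simp: card_insert_if)
      ultimately have c: "card ?P = card ?S" using P(2) by simp
      have "closed_in E (V - ?S) A" if "A \<in> P - {C}" for A
      proof (rule closed_in_mono[of _ "V - S"])
        show "closed_in E (V - S) A" using P(1) that unfolding odd_family_def by blast
        have "A \<inter> C = {}" using that disjP C by blast
        then show "A \<subseteq> V - ?S" using that T v subP by blast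
      qed blast
      \<comment> \<open>An edge avoiding \<open>?S\<close> that meets \<open>A\<close> also meets
        \<open>C\<close>, so it stays in \<open>C\<close> and hence in \<open>C - {v} - T\<close>,
        where \<open>A\<close> is closed.\<close>
      moreover have "closed_in E (V - ?S) A" if A: "A \<in> R" for A
      proof -
        have clA: "closed_in E (C - {v} - T) A" using R(1) A unfolding odd_family_def by blast
        then have AC: "A \<subseteq> C - {v} - T" unfolding closed_in_def by blast
        show ?thesis unfolding closed_in_def
        proof (intro conjI ballI impI)
          show "A \<subseteq> V - ?S" using AC C subP by blast
          fix e assume e: "e \<in> E" "e \<subseteq> V - ?S" "e \<inter> A \<noteq> {}"
          have "e \<subseteq> V - S" "e \<inter> C \<noteq> {}" using e(2,3) AC by auto
          then have "e \<subseteq> C" using clC e(1) unfolding closed_in_def by simp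
          then have "e \<subseteq> C - {v} - T" using e(2) by blast
          then show "e \<subseteq> A" using clA e(1,3) unfolding closed_in_def by blast
        qed
      qed
      moreover have "disjoint ?P"
      proof (rule disjointI)
        fix A B assume AB: "A \<in> ?P" "B \<in> ?P" "A \<noteq> B"
        have "A \<inter> B = {}" if "A \<in> R" "B \<in> R"
          using R(1) that AB(3) unfolding odd_family_def disjoint_def by blast
        moreover have "D \<inter> D' = {}" if "D \<in> P - {C}" "D' \<in> R" for D D'
          using disjP[of D C] C that subR by blast
        ultimately show "A \<inter> B = {}" using AB disjP[of A B] by blast
      qed
      moreover have "odd (card A)" if "A \<in> ?P" for A
        using P(1) R(1) that unfolding odd_family_def by blast
      ultimately have "odd_family E (V - ?S) ?P" unfolding odd_family_def by blast
      moreover have "?S \<subseteq> V" using SV T C v subP by blast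
      ultimately have "good ?S" unfolding good_def using c by blast
      then have "card ?S \<le> card S" using S(2) by blast
      then show False using \<open>card ?S = card S + Suc (card T)\<close> by simp
    qed
  qed
  define N where "N C = {s\<in>S. \<exists>x\<in>C. {s, x} \<in> E}" for C
  have "\<exists>f. inj_on f P \<and> (\<forall>C\<in>P. f C \<in> N C)"
  proof (rule hall_marriage[OF finP])
    show "finite (N C)" for C unfolding N_def using finS by simp
    fix J assume J: "J \<subseteq> P"
    show "card J \<le> card (\<Union>(N ` J))"
    proof (rule tutte)
      show "\<Union>(N ` J) \<subseteq> V" unfolding N_def using SV by blast
      have "closed_in E (V - \<Union>(N ` J)) A" if A: "A \<in> J" for A
        unfolding closed_in_def
      proof (intro conjI ballI impI)
        have clA: "closed_in E (V - S) A" using A J P(1) unfolding odd_family_def by blast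
        then show "A \<subseteq> V - \<Union>(N ` J)" unfolding closed_in_def N_def by blast
        fix e assume e: "e \<in> E" "e \<subseteq> V - \<Union>(N ` J)" "e \<inter> A \<noteq> {}"
        then obtain x where x: "x \<in> e" "x \<in> A" by blast
        obtain y where y: "e = {x, y}"
          using assms(2)[OF e(1)] x(1) by (auto simp: card_2_iff)
        have "y \<notin> S"
        proof
          assume "y \<in> S"
          then have "y \<in> N A" unfolding N_def using x(2) e(1) y by (auto simp: insert_commute)
          then show False using e(2) y A by blast
        qed
        then have "e \<subseteq> V - S" using y x clA e(2) unfolding closed_in_def by blast
        then show "e \<subseteq> A" using clA e unfolding closed_in_def by blast
      qed
      then show "odd_family E (V - \<Union>(N ` J)) J"
        using odd_family_subset[OF P(1) J] unfolding odd_family_def by blast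
    qed
  qed
  then obtain f where f: "inj_on f P" "\<And>C. C \<in> P \<Longrightarrow> f C \<in> N C" by blast
  have fS: "f ` P \<subseteq> S" using f(2) unfolding N_def by blast
  \<comment> \<open>As \<open>card P = card S\<close>, the injection is onto, so the sets
    \<open>insert (f C) C\<close> partition \<open>V\<close>. Each is matched by one edge from
    \<open>f C\<close> into \<open>C\<close> together with a matching of the remainder of
    \<open>C\<close>.\<close>
  then have "f ` P = S"
    using finS card_image[OF f(1)] P(2) by (intro card_subset_eq) auto
  then have "V = (\<Union>C\<in>P. insert (f C) C)" using UP SV by blast
  moreover have "matchable E (\<Union>C\<in>P. insert (f C) C)"
  proof (rule matchable_UN[OF finP])
    fix C assume C: "C \<in> P"
    obtain x where x: "x \<in> C" "{f C, x} \<in> E" using f(2)[OF C] unfolding N_def by blast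
    have "f C \<notin> C" using fS C subP by blast
    then have "matchable E ({f C, x} \<union> (C - {x}))"
      using matchable_edge[OF x(2)] match[OF C x(1)] by (intro matchable_Un) auto
    moreover have "{f C, x} \<union> (C - {x}) = insert (f C) C" using x by blast
    ultimately show "matchable E (insert (f C) C)" by simp
  next
    fix C D assume CD: "C \<in> P" "D \<in> P" "C \<noteq> D"
    have "f C \<noteq> f D" using f(1) CD by (auto simp: inj_on_def)
    moreover have "f C \<in> S" "f D \<in> S" using fS CD by auto
    ultimately show "insert (f C) C \<inter> insert (f D) D = {}"
      using CD disjP subP by blast
  qed
  ultimately show ?case by simp
qed

subsection \<open>Simple graphs and fractional matchings\<close>

lemma simple_graphD:
  assumes "simple_graph G" "e \<in> edges G"
  shows "e \<subseteq> verts G" "card e = 2"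
  using assms unfolding simple_graph_def by auto

lemma simple_graph_finite:
  assumes "simple_graph G"
  shows "finite (verts G)" "finite (edges G)"
proof -
  show fin: "finite (verts G)" using assms unfolding simple_graph_def by blast
  have "edges G \<subseteq> Pow (verts G)" using simple_graphD(1)[OF assms] by blast
  then show "finite (edges G)" using fin finite_subset by blast
qed

lemma simple_graph_delete_verts: "simple_graph G \<Longrightarrow> simple_graph (delete_verts G X)"
  unfolding simple_graph_def delete_verts_def by auto

lemma degree_eq_card_neighbours:
  assumes "simple_graph G"
  shows "degree G v = card {u. {v, u} \<in> edges G}"
proof -
  have inj: "inj_on (\<lambda>u. {v, u}) {u. {v, u} \<in> edges G}"
    by (auto simp: inj_on_def doubleton_eq_iff)
  have "(\<lambda>u. {v, u}) ` {u. {v, u} \<in> edges G} = {e \<in> edges G. v \<in> e}"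
  proof (intro equalityI subsetI)
    fix e assume e: "e \<in> {e \<in> edges G. v \<in> e}"
    then obtain u where "e = {v, u}"
      using simple_graphD(2)[OF assms, of e] by (auto simp: card_2_iff)
    then show "e \<in> (\<lambda>u. {v, u}) ` {u. {v, u} \<in> edges G}" using e by simp
  qed auto
  then show ?thesis unfolding degree_def using card_image[OF inj] by simp
qed

lemma neighbours_subset:
  assumes "simple_graph G"
  shows "{u. {v, u} \<in> edges G} \<subseteq> verts G - {v}"
proof
  fix u assume "u \<in> {u. {v, u} \<in> edges G}"
  then have "{v, u} \<subseteq> verts G" "card {v, u} = 2" using simple_graphD[OF assms, of "{v, u}"] by auto
  then show "u \<in> verts G - {v}" by auto
qed

lemma min_degree_le:
  assumes "simple_graph G" "v \<in> verts G"
  shows "min_degree G \<le> degree G v"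
  using assms simple_graph_finite(1) unfolding min_degree_def by (intro Min_le) auto

lemma min_degree_attained:
  assumes "simple_graph G" "verts G \<noteq> {}"
  shows "\<exists>v\<in>verts G. degree G v = min_degree G"
proof -
  have "Min (degree G ` verts G) \<in> degree G ` verts G"
    using assms simple_graph_finite(1)[OF assms(1)] by (intro Min_in) auto
  then show ?thesis unfolding min_degree_def by auto
qed

lemma matchable_imp_perfect_matching:
  "matchable (edges G) (verts G) \<Longrightarrow> \<exists>M. perfect_matching G M"
  unfolding matchable_def perfect_matching_def by blast

text \<open>Double counting of incidences: after exchanging the sums, each vertex of
  \<open>A\<close> contributes the total weight 1 of its edges.\<close>

lemma fractional_perfect_matching_weight:
  assumes "simple_graph G" "fractional_perfect_matching G h" "A \<subseteq> verts G"
  shows "(\<Sum>e\<in>edges G. h e * real (card (e \<inter> A))) = real (card A)"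
proof -
  have finE: "finite (edges G)" and finA: "finite A"
    using simple_graph_finite[OF assms(1)] assms(3) finite_subset by auto
  have "(\<Sum>e\<in>edges G. h e * real (card (e \<inter> A))) = (\<Sum>e\<in>edges G. \<Sum>v\<in>A. if v \<in> e then h e else 0)"
  proof (rule sum.cong[OF refl])
    fix e
    have "(\<Sum>v\<in>A. if v \<in> e then h e else 0) = (\<Sum>v\<in>A \<inter> e. h e)"
      using sum.inter_restrict[OF finA, of "\<lambda>_. h e" e] by (rule sym)
    then show "h e * real (card (e \<inter> A)) = (\<Sum>v\<in>A. if v \<in> e then h e else 0)"
      by (simp add: Int_commute)
  qed
  also have "\<dots> = (\<Sum>v\<in>A. \<Sum>e\<in>edges G. if v \<in> e then h e else 0)" by (rule sum.swap)
  also have "\<dots> = (\<Sum>v\<in>A. \<Sum>e\<in>{e \<in> edges G. v \<in> e}. h e)"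
    using finE by (simp add: sum.inter_filter)
  also have "\<dots> = (\<Sum>v\<in>A. 1)"
    using assms(2,3) unfolding fractional_perfect_matching_def by (intro sum.cong) auto
  finally show ?thesis by simp
qed

text \<open>Every edge meeting \<open>I\<close> has its other end in \<open>S\<close>, so edge by
  edge the weight seen from \<open>I\<close> is at most the weight seen from \<open>S\<close>; these
  total \<open>card I\<close> and \<open>card S\<close>.\<close>

lemma fractional_perfect_matching_isolated:
  assumes G: "simple_graph G" and h: "fractional_perfect_matching G h" and S: "S \<subseteq> verts G"
    and I: "I \<subseteq> verts G - S" and cl: "\<And>v. v \<in> I \<Longrightarrow> closed_in (edges G) (verts G - S) {v}"
  shows "card I \<le> card S"
proof -
  have "(\<Sum>e\<in>edges G. h e * real (card (e \<inter> I))) \<le> (\<Sum>e\<in>edges G. h e * real (card (e \<inter> S)))"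
  proof (rule sum_mono)
    fix e assume e: "e \<in> edges G"
    have "card (e \<inter> I) \<le> card (e \<inter> S)"
    proof (cases "e \<inter> I = {}")
      case False
      then obtain v where v: "v \<in> e" "v \<in> I" by blast
      then obtain w where w: "e = {v, w}" "v \<noteq> w"
        using simple_graphD(2)[OF G e] by (auto simp: card_2_iff)
      have "\<not> e \<subseteq> verts G - S"
        using cl[OF v(2)] e v(1) w unfolding closed_in_def by blast
      then have "w \<in> S" using simple_graphD(1)[OF G e] w v I by blast
      then have "e \<inter> I = {v}" "e \<inter> S = {w}" using w v I by auto
      then show ?thesis by simp
    qed simp
    moreover have "0 \<le> h e" using h e unfolding fractional_perfect_matching_def by blast
    ultimately show "h e * real (card (e \<inter> I)) \<le> h e * real (card (e \<inter> S))"
      by (intro mult_left_mono) auto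
  qed
  moreover have "I \<subseteq> verts G" using I by blast
  ultimately show ?thesis
    using fractional_perfect_matching_weight[OF G h S] fractional_perfect_matching_weight[OF G h, of I]
    by simp
qed

subsection \<open>Barriers\<close>

text \<open>All pairs that a barrier \<open>S\<close> with parts \<open>Q\<close> permits: the edges
  of the join of a clique on \<open>S\<close> with disjoint cliques on the members of
  \<open>Q\<close>.\<close>

definition cluster_edges :: "'a set \<Rightarrow> 'a set \<Rightarrow> 'a set set \<Rightarrow> 'a set set" where
  "cluster_edges V S Q = {e. e \<subseteq> V \<and> card e = 2 \<and> (e \<inter> S \<noteq> {} \<or> (\<exists>A\<in>Q. e \<subseteq> A))}"

lemma two_choose_two: "2 * int (n choose 2) = (int n)\<^sup>2 - int n"
proof -
  have "even (n * (n - 1))" by (cases n) auto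
  then have "2 * (n choose 2) = n * (n - 1)" by (simp only: choose_two dvd_mult_div_cancel)
  then have "2 * int (n choose 2) = int (n * (n - 1))" by (metis of_nat_mult of_nat_numeral)
  also have "\<dots> = (int n)\<^sup>2 - int n" by (cases n) (auto simp: power2_eq_square algebra_simps)
  finally show ?thesis .
qed

text \<open>Take all pairs, remove those inside \<open>V - S\<close>, and add those inside a part.
  The linear terms of the last two counts cancel because the parts partition \<open>V - S\<close>.
  Doubling avoids division, and integers avoid truncated subtraction.\<close>

lemma card_cluster_edges:
  assumes V: "finite V" and S: "S \<subseteq> V" and Q: "disjoint Q" "\<Union>Q = V - S"
  shows "2 * int (card (cluster_edges V S Q)) =
    (int (card V))\<^sup>2 - int (card V) - (int (card V) - int (card S))\<^sup>2 + (\<Sum>A\<in>Q. (int (card A))\<^sup>2)"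
proof -
  let ?p = "\<lambda>A. {e. e \<subseteq> A \<and> card e = 2}"
  have finQ: "finite Q" using Q(2) V by (metis finite_Diff finite_UnionD)
  have finA: "finite A" if "A \<in> Q" for A using that Q(2) V by (metis Union_upper finite_Diff finite_subset)
  have finp: "finite (?p A)" if "finite A" for A :: "'a set" using that by simp
  have cp: "2 * int (card (?p A)) = (int (card A))\<^sup>2 - int (card A)" if "finite A" for A :: "'a set"
    using n_subsets[OF that, of 2] two_choose_two by simp
  have ne: "e \<noteq> {}" if "card e = 2" for e :: "'a set" using that by force
  have eq: "cluster_edges V S Q = (?p V - ?p (V - S)) \<union> (\<Union>A\<in>Q. ?p A)"
    unfolding cluster_edges_def using Q(2) by blast
  have "card (\<Union>A\<in>Q. ?p A) = (\<Sum>A\<in>Q. card (?p A))"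
  proof (rule card_UN_disjoint[OF finQ])
    show "\<forall>A\<in>Q. \<forall>B\<in>Q. A \<noteq> B \<longrightarrow> ?p A \<inter> ?p B = {}"
    proof (intro ballI impI)
      fix A B assume AB: "A \<in> Q" "B \<in> Q" "A \<noteq> B"
      then have "A \<inter> B = {}" using Q(1) by (auto dest: disjointD)
      then have "e = {}" if "e \<in> ?p A \<inter> ?p B" for e using that by blast
      then show "?p A \<inter> ?p B = {}" using ne by blast
    qed
  qed (use finA in simp)
  then have "2 * int (card (\<Union>A\<in>Q. ?p A)) = (\<Sum>A\<in>Q. 2 * int (card (?p A)))"
    by (simp add: sum_distrib_left)
  also have "\<dots> = (\<Sum>A\<in>Q. (int (card A))\<^sup>2 - int (card A))"
    using cp finA by (intro sum.cong) auto
  also have "\<dots> = (\<Sum>A\<in>Q. (int (card A))\<^sup>2) - int (card (V - S))"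
    using card_Union_disjoint[of Q] Q finA by (simp add: sum_subtractf)
  finally have U: "2 * int (card (\<Union>A\<in>Q. ?p A)) = \<dots>" .
  have "card (?p V - ?p (V - S)) = card (?p V) - card (?p (V - S))"
    using finp[of "V - S"] V by (intro card_Diff_subset) auto
  moreover have "card (?p (V - S)) \<le> card (?p V)" using finp[OF V] by (intro card_mono) auto
  ultimately have D: "2 * int (card (?p V - ?p (V - S))) =
    (int (card V))\<^sup>2 - int (card V) - ((int (card (V - S)))\<^sup>2 - int (card (V - S)))"
    using cp[OF V] cp[of "V - S"] V by simp
  have disj: "(?p V - ?p (V - S)) \<inter> (\<Union>A\<in>Q. ?p A) = {}" using Q(2) by blast
  have "finite (\<Union>A\<in>Q. ?p A)" using finQ finA finp by blast
  then have "card (cluster_edges V S Q) = card (?p V - ?p (V - S)) + card (\<Union>A\<in>Q. ?p A)"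
    unfolding eq using finp[OF V] disj by (intro card_Un_disjoint) auto
  moreover have "int (card (V - S)) = int (card V) - int (card S)"
    using S V card_mono[OF V S] by (simp add: card_Diff_subset finite_subset of_nat_diff)
  ultimately show ?thesis using U D by simp
qed

text \<open>\<open>S\<close> is \<open>X \<union> T\<close>, where \<open>X\<close> is a set of
  \<open>k\<close> vertices whose deletion destroys all perfect matchings and \<open>T\<close>
  violates Tutte's condition in what remains. Saturation gives exactly \<open>card T + 2\<close> odd
  parts, and a fractional matching of the remaining graph bounds the singletons by
  \<open>card T\<close>.\<close>

lemma not_factor_critical_obtains:
  assumes G: "simple_graph G" and conn: "t_connected (k + 1) G"
    and frac: "fractional_factor_critical k G" and par: "even (card (verts G) + k)"
    and nfc: "\<not> factor_critical k G"
  obtains S Q where "S \<subseteq> verts G" "k < card S" "disjoint Q" "\<Union>Q = verts G - S"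
    "card Q + k = card S + 2" "\<And>A. A \<in> Q \<Longrightarrow> odd (card A)"
    "edges G \<subseteq> cluster_edges (verts G) S Q"
    "card {A \<in> Q. card A = 1} + k \<le> card S"
proof -
  have finV: "finite (verts G)" using simple_graph_finite[OF G] by blast
  have "k < card (verts G)" using conn unfolding t_connected_def graph_order_def by simp
  then obtain X where X: "X \<subseteq> verts G" "card X = k" and nopm: "\<nexists>M. perfect_matching (delete_verts G X) M"
    using nfc unfolding factor_critical_def graph_order_def by blast
  let ?D = "delete_verts G X"
  have D: "simple_graph ?D" using simple_graph_delete_verts[OF G] .
  have finX: "finite X" using X finV finite_subset by blast
  have vD: "verts ?D = verts G - X" and eD: "edges ?D = {e \<in> edges G. e \<inter> X = {}}"
    unfolding delete_verts_def by simp_all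
  have "card (verts ?D) + k = card (verts G)"
    unfolding vD using X finX finV by (metis card_Diff_subset card_mono le_add_diff_inverse2)
  then have evD: "even (card (verts ?D))" using par by presburger
  have finD: "finite (verts ?D)" using simple_graph_finite[OF D] by blast
  have "\<not> matchable (edges ?D) (verts ?D)" using matchable_imp_perfect_matching nopm by blast
  then obtain T P where T: "T \<subseteq> verts ?D" and "odd_family (edges ?D) (verts ?D - T) P" "card T < card P"
    using tutte_matchable[OF finD simple_graphD(2)[OF D]] by (meson not_le)
  then obtain Q where Q: "odd_family (edges ?D) (verts ?D - T) Q" "card Q = card T + 2"
      "\<Union>Q = verts ?D - T"
    using odd_family_saturate[OF finD evD] by blast
  have oddQ: "odd (card A)" and clQ: "closed_in (edges ?D) (verts ?D - T) A" if "A \<in> Q" for A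
    using Q(1) that unfolding odd_family_def by auto
  have disjQ: "disjoint Q" using Q(1) unfolding odd_family_def by blast
  have finT: "finite T" using T finD finite_subset by blast
  have TX: "T \<inter> X = {}" using T vD by blast
  let ?S = "X \<union> T"
  have cS: "card ?S = k + card T" using X finX finT TX by (simp add: card_Un_disjoint Int_commute)
  have UQ: "\<Union>Q = verts G - ?S" using Q(3) vD by blast
  \<comment> \<open>For empty \<open>T\<close> the two parts would be nonempty with no edge between
    them, but deleting only \<open>k < k + 1\<close> vertices leaves \<open>G\<close>
    connected.\<close>
  have "T \<noteq> {}"
  proof
    assume T0: "T = {}"
    then have "card Q = 2" using Q(2) by simp
    then obtain A B where AB: "A \<in> Q" "B \<in> Q" "A \<noteq> B" by (auto simp: card_2_iff)
    then have "A \<inter> B = {}" using disjQ by (auto dest: disjointD)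
    moreover have "A \<noteq> {}" "B \<noteq> {}" using oddQ[OF AB(1)] oddQ[OF AB(2)] by auto
    ultimately obtain a b where ab: "a \<in> A" "b \<in> B" "b \<notin> A" by blast
    have "connected_graph ?D" using conn X unfolding t_connected_def by simp
    moreover have "a \<in> verts ?D" "b \<in> verts ?D" using ab AB Q(3) by blast+
    ultimately have "(a, b) \<in> {(x, y). {x, y} \<in> edges ?D}\<^sup>*" unfolding connected_graph_def by blast
    then have "b \<in> A"
    proof (induction rule: rtrancl_induct)
      case base
      then show ?case using ab by blast
    next
      case (step y z)
      then have e: "{y, z} \<in> edges ?D" by simp
      moreover have "{y, z} \<subseteq> verts ?D - T" using simple_graphD(1)[OF D e] T0 by simp
      moreover have "{y, z} \<inter> A \<noteq> {}" using step.IH by simp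
      ultimately have "{y, z} \<subseteq> A" by (rule closed_inD[OF clQ[OF AB(1)]])
      then show ?case by simp
    qed
    then show False using ab by blast
  qed
  then have T1: "0 < card T" using finT card_gt_0_iff by blast
  have "edges G \<subseteq> cluster_edges (verts G) ?S Q"
  proof
    fix e assume e: "e \<in> edges G"
    have e2: "e \<subseteq> verts G" "card e = 2" using simple_graphD[OF G e] by auto
    have "\<exists>A\<in>Q. e \<subseteq> A" if eS: "e \<inter> ?S = {}"
    proof -
      obtain x where x: "x \<in> e" using e2(2) by fastforce
      then obtain A where A: "A \<in> Q" "x \<in> A" using UQ e2(1) eS by blast
      have "e \<in> edges ?D" "e \<subseteq> verts ?D - T" using e eS e2(1) unfolding eD vD by auto
      moreover have "e \<inter> A \<noteq> {}" using A x by blast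
      ultimately show ?thesis using closed_inD[OF clQ[OF A(1)]] A(1) by blast
    qed
    then show "e \<in> cluster_edges (verts G) ?S Q" unfolding cluster_edges_def using e2 by blast
  qed
  moreover have "card {A \<in> Q. card A = 1} \<le> card T"
  proof -
    obtain h where h: "fractional_perfect_matching ?D h"
      using frac X unfolding fractional_factor_critical_def by blast
    let ?I = "{v. {v} \<in> Q}"
    have "card ?I \<le> card T"
      using Q(3) clQ by (intro fractional_perfect_matching_isolated[OF D h T]) blast+
    moreover have "{A \<in> Q. card A = 1} = (\<lambda>v. {v}) ` ?I"
      by (auto simp: card_1_singleton_iff)
    ultimately show ?thesis by (simp add: card_image)
  qed
  ultimately show ?thesis
    using that[of ?S Q] X T vD cS T1 disjQ UQ Q(2) oddQ by auto
qed

subsection \<open>Extremal estimates\<close>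

lemma sum_squares_le_square_sum:
  fixes g :: "'b \<Rightarrow> int"
  assumes "finite Q" "\<And>x. x \<in> Q \<Longrightarrow> 0 \<le> g x"
  shows "(\<Sum>x\<in>Q. (g x)\<^sup>2) \<le> (\<Sum>x\<in>Q. g x)\<^sup>2"
  using assms
proof (induction Q rule: finite_induct)
  case (insert x Q)
  have "0 \<le> 2 * (g x * (\<Sum>y\<in>Q. g y))" using insert.prems by (simp add: sum_nonneg)
  then show ?case using insert by (simp add: power2_sum)
qed simp

text \<open>After subtracting the minimum \<open>m\<close>, the sum of squares of nonnegative
  numbers is at most the square of their sum. For nonempty \<open>Q\<close> the bound is
  \<open>(card Q - 1) * m\<^sup>2 + (m + B)\<^sup>2\<close>: the whole surplus \<open>B\<close> sits
  in one term.\<close>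

lemma sum_squares_le_concentrated:
  fixes a :: "'b \<Rightarrow> int" and m B :: int
  assumes "finite Q" "\<And>x. x \<in> Q \<Longrightarrow> m \<le> a x" "(\<Sum>x\<in>Q. a x) = m * int (card Q) + B"
  shows "(\<Sum>x\<in>Q. (a x)\<^sup>2) \<le> int (card Q) * m\<^sup>2 + 2 * m * B + B\<^sup>2"
proof -
  have B: "(\<Sum>x\<in>Q. a x - m) = B" using assms(3) by (simp add: sum_subtractf mult.commute)
  have "(\<Sum>x\<in>Q. (a x - m)\<^sup>2) \<le> B\<^sup>2"
    using sum_squares_le_square_sum[OF assms(1), of "\<lambda>x. a x - m"] assms(2) B by simp
  moreover have "(\<Sum>x\<in>Q. (a x)\<^sup>2) = (\<Sum>x\<in>Q. m\<^sup>2 + 2 * m * (a x - m) + (a x - m)\<^sup>2)"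
    by (intro sum.cong) (auto simp: power2_eq_square algebra_simps)
  moreover have "\<dots> = int (card Q) * m\<^sup>2 + 2 * m * (\<Sum>x\<in>Q. a x - m) + (\<Sum>x\<in>Q. (a x - m)\<^sup>2)"
    by (simp only: sum.distrib sum_distrib_left sum_constant of_int_of_nat_eq)
  ultimately show ?thesis using B by simp
qed

text \<open>Compares twice the edge bounds of a barrier and of the extremal graph, without the
  common \<open>n\<^sup>2 - n\<close>; \<open>m\<close> is a lower bound for the part sizes and
  \<open>B\<close> the surplus. In each case the difference expands into visibly nonnegative terms
  plus a positive one.\<close>

lemma small_barrier_bound:
  fixes N t m B d :: int
  assumes "1 \<le> t" "3 \<le> m" "0 \<le> B" "d = t + 1 \<and> m = 3 \<or> d = t + m - 1"
    and "N = B + t + (t + 2) * m"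
  shows "- (N - t)\<^sup>2 + (t + 2) * m\<^sup>2 + 2 * m * B + B\<^sup>2 < - (N - d)\<^sup>2 + (N - 2 * d - 3)\<^sup>2 + 9 + d"
  using assms(4)
proof
  assume d: "d = t + 1 \<and> m = 3"
  have "- (N - d)\<^sup>2 + (N - 2 * d - 3)\<^sup>2 + 9 + d - (- (N - t)\<^sup>2 + (t + 2) * m\<^sup>2 + 2 * m * B + B\<^sup>2)
      = B * (4 * t - 2) + 4 * t\<^sup>2 + 2 * t + 4"
    using d assms(5) by (simp add: power2_eq_square algebra_simps)
  moreover have "0 \<le> B * (4 * t - 2)" "0 \<le> t\<^sup>2" using assms by simp_all
  ultimately show ?thesis using assms(1) by linarith
next
  assume d: "d = t + m - 1"
  have "- (N - d)\<^sup>2 + (N - 2 * d - 3)\<^sup>2 + 9 + d - (- (N - t)\<^sup>2 + (t + 2) * m\<^sup>2 + 2 * m * B + B\<^sup>2)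
      = 2 * (B * (t * (m - 1) - 2)) + m * (m - 1) + 8 + t * ((m - 1) * (m - 3)) + (t * (m - 1))\<^sup>2"
    unfolding d assms(5) by (simp add: power2_eq_square algebra_simps)
  moreover have "1 * 2 \<le> t * (m - 1)" using assms by (intro mult_mono) auto
  then have "0 \<le> B * (t * (m - 1) - 2)" using assms(3) by simp
  moreover have "0 \<le> m * (m - 1)" "0 \<le> t * ((m - 1) * (m - 3))" "0 \<le> (t * (m - 1))\<^sup>2"
    using assms by simp_all
  ultimately show ?thesis by linarith
qed

text \<open>The bound is a convex quadratic in \<open>t\<close>, so its increment from
  \<open>d\<close> to \<open>t\<close> has the factor \<open>t - d\<close>; the other factor is
  linear, and the lower bounds on \<open>N\<close> fix its sign.\<close>

lemma large_barrier_bound: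
  fixes N t d :: int
  assumes "d \<le> t" "2 * t + 6 \<le> N" "6 * d + 8 \<le> N"
  shows "- (N - t)\<^sup>2 + (N - 2 * t - 3)\<^sup>2 + t \<le> - (N - d)\<^sup>2 + (N - 2 * d - 3)\<^sup>2 + d"
proof -
  have "- (N - d)\<^sup>2 + (N - 2 * d - 3)\<^sup>2 + d - (- (N - t)\<^sup>2 + (N - 2 * t - 3)\<^sup>2 + t)
      = (t - d) * (2 * N - 3 * (t + d) - 13)"
    by (simp add: power2_eq_square algebra_simps)
  \<comment> \<open>Three halves of \<open>2 * t + 6 \<le> N\<close> plus one half of
    \<open>6 * d + 8 \<le> N\<close> give exactly this, with no slack in the constant 13.\<close>
  moreover have "0 \<le> 2 * N - 3 * (t + d) - 13" using assms by presburger
  then have "0 \<le> (t - d) * (2 * N - 3 * (t + d) - 13)" using assms(1) by simp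
  ultimately show ?thesis by linarith
qed

subsection \<open>The extremal graph\<close>

lemma edge_graph_union [simp]:
  fixes G :: "'a graph" and H :: "'b graph"
  shows
  "{Inl a, Inl b} \<in> edges (graph_union G H) \<longleftrightarrow> {a, b} \<in> edges G"
  "{Inr c, Inr d} \<in> edges (graph_union G H) \<longleftrightarrow> {c, d} \<in> edges H"
  "{Inl a, Inr d} \<notin> edges (graph_union G H)"
  "{Inr d, Inl a} \<notin> edges (graph_union G H)"
proof -
  have l: "{Inl a, Inl b} = Inl ` e \<longleftrightarrow> {a, b} = e" for e :: "'a set"
    using inj_image_eq_iff[OF inj_Inl, of "{a, b}" e] by simp
  have r: "{Inr c, Inr d} = Inr ` e \<longleftrightarrow> {c, d} = e" for e :: "'b set"
    using inj_image_eq_iff[OF inj_Inr, of "{c, d}" e] by simp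
  have lr: "{Inl a, Inl b} \<noteq> Inr ` e" "{Inr c, Inr d} \<noteq> Inl ` e'" for e :: "'b set" and e' :: "'a set"
    by auto
  show "{Inl a, Inl b} \<in> edges (graph_union G H) \<longleftrightarrow> {a, b} \<in> edges G"
    "{Inr c, Inr d} \<in> edges (graph_union G H) \<longleftrightarrow> {c, d} \<in> edges H"
    unfolding graph_union_def by (simp_all add: image_iff l r lr)
  show "{Inl a, Inr d} \<notin> edges (graph_union G H)" "{Inr d, Inl a} \<notin> edges (graph_union G H)"
    unfolding graph_union_def by auto
qed

lemma edge_graph_join [simp]:
  "{Inl a, Inl b} \<in> edges (graph_join G H) \<longleftrightarrow> {a, b} \<in> edges G"
  "{Inr c, Inr d} \<in> edges (graph_join G H) \<longleftrightarrow> {c, d} \<in> edges H"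
  "{Inl a, Inr d} \<in> edges (graph_join G H) \<longleftrightarrow> a \<in> verts G \<and> d \<in> verts H"
  "{Inr d, Inl a} \<in> edges (graph_join G H) \<longleftrightarrow> a \<in> verts G \<and> d \<in> verts H"
  unfolding graph_join_def by (auto simp: doubleton_eq_iff)

lemma edge_complete_graph [simp]:
  "{a, b} \<in> edges (complete_graph m) \<longleftrightarrow> a < m \<and> b < m \<and> a \<noteq> b"
  unfolding complete_graph_def by (auto simp: doubleton_eq_iff)

lemma edges_copies_complete_1 [simp]: "edges (graph_copies a (complete_graph (Suc 0))) = {}"
  unfolding graph_copies_def complete_graph_def by auto

section \<open>The four vertex classes of the extremal graph\<close>

definition ext_hub :: "nat \<Rightarrow> (nat + ((nat + nat) + (nat \<times> nat))) set" where
  "ext_hub p = Inl ` {..<p}"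

definition ext_big :: "nat \<Rightarrow> (nat + ((nat + nat) + (nat \<times> nat))) set" where
  "ext_big p = (\<lambda>i. Inr (Inl (Inl i))) ` {..<p}"

definition ext_tri :: "(nat + ((nat + nat) + (nat \<times> nat))) set" where
  "ext_tri = (\<lambda>i. Inr (Inl (Inr i))) ` {..<3}"

text \<open>The second component is 0, the only vertex of \<open>complete_graph 1\<close>.\<close>

definition ext_iso :: "nat \<Rightarrow> (nat + ((nat + nat) + (nat \<times> nat))) set" where
  "ext_iso p = (\<lambda>i. Inr (Inr (i, 0))) ` {..<p}"

lemmas ext_defs = ext_hub_def ext_big_def ext_tri_def ext_iso_def

lemma card_ext:
  "card (ext_hub p) = p" "card (ext_big p) = p" "card ext_tri = 3" "card (ext_iso p) = p"
  unfolding ext_defs by (subst card_image; simp add: inj_on_def)+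

lemma finite_ext: "finite (ext_hub p)" "finite (ext_big p)" "finite ext_tri" "finite (ext_iso p)"
  unfolding ext_defs by simp_all

lemma disjoint_ext:
  "ext_hub p \<inter> ext_big q = {}" "ext_hub p \<inter> ext_tri = {}" "ext_hub p \<inter> ext_iso r = {}"
  "ext_big q \<inter> ext_tri = {}" "ext_big q \<inter> ext_iso r = {}" "ext_tri \<inter> ext_iso r = {}"
  unfolding ext_defs by auto

lemma verts_extremal_graph:
  "verts (extremal_graph n \<delta> k) =
     ext_hub \<delta> \<union> ext_big (n + k - (2 * \<delta> + 3)) \<union> ext_tri \<union> ext_iso (\<delta> - k)"
  unfolding extremal_graph_def graph_join_def graph_union_def graph_copies_def complete_graph_def ext_defs
  by (auto simp: image_iff Plus_def)

lemma edge_extremal_graph: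
  assumes "x \<in> verts (extremal_graph n \<delta> k)" "y \<in> verts (extremal_graph n \<delta> k)"
  defines "p \<equiv> n + k - (2 * \<delta> + 3)"
  shows "{x, y} \<in> edges (extremal_graph n \<delta> k) \<longleftrightarrow>
    x \<noteq> y \<and> (x \<in> ext_hub \<delta> \<or> y \<in> ext_hub \<delta> \<or> x \<in> ext_big p \<and> y \<in> ext_big p \<or> x \<in> ext_tri \<and> y \<in> ext_tri)"
proof -
  note d = extremal_graph_def ext_defs p_def
  have v: "Inr z \<in> verts (extremal_graph n \<delta> k) \<longleftrightarrow>
    z \<in> verts (graph_union (graph_union (complete_graph p) (complete_graph 3)) (graph_copies (\<delta> - k) (complete_graph 1)))"
    "Inl i \<in> verts (extremal_graph n \<delta> k) \<longleftrightarrow> i < \<delta>" for z i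
    unfolding extremal_graph_def graph_join_def p_def by (auto simp: graph_union_def complete_graph_def)
  have c: "i \<in> verts (complete_graph m) \<longleftrightarrow> i < m" for i m by (simp add: complete_graph_def)
  show ?thesis
  proof (cases x)
    case x: (Inl i)
    show ?thesis
    proof (cases y)
      case (Inl j)
      then show ?thesis using assms(1,2) x v by (auto simp: d)
    next
      case (Inr z)
      then show ?thesis using assms(1,2) x v c by (auto simp: d)
    qed
  next
    case x: (Inr z)
    show ?thesis
    proof (cases y)
      case (Inl j)
      then show ?thesis using assms(1,2) x v c by (auto simp: d)
    next
      case y: (Inr w)
      have "{x, y} \<in> edges (extremal_graph n \<delta> k) \<longleftrightarrow> {z, w} \<in> edges (graph_union (graph_union (complete_graph p) (complete_graph 3)) (graph_copies (\<delta> - k) (complete_graph 1)))"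
        unfolding x y extremal_graph_def p_def by simp
      also have "\<dots> \<longleftrightarrow> x \<noteq> y \<and> (x \<in> ext_big p \<and> y \<in> ext_big p \<or> x \<in> ext_tri \<and> y \<in> ext_tri)"
      proof (cases z)
        case z: (Inl z')
        show ?thesis
        proof (cases w)
          case w: (Inl w')
          show ?thesis unfolding x y z w by (cases z'; cases w') (auto simp: ext_defs)
        qed (auto simp: x y z ext_defs)
      next
        case z: (Inr z')
        show ?thesis unfolding x y z by (cases w) (auto simp: ext_defs)
      qed
      finally show ?thesis unfolding x y by (auto simp: ext_defs)
    qed
  qed
qed

text \<open>The extremal graph has every edge permitted by the barrier
  \<open>ext_hub \<delta>\<close> with parts the large clique, the triangle and the singletons. An
  inequality suffices, since the count only enters as a lower bound for
  \<open>card (edges G)\<close>.\<close>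

lemma card_edges_extremal_graph_ge:
  assumes "k \<le> \<delta>" "2 * \<delta> + 3 \<le> n + k"
  shows "(int n)\<^sup>2 - int n - (int n - int \<delta>)\<^sup>2 + (int n + int k - 2 * int \<delta> - 3)\<^sup>2 + 9 + (int \<delta> - int k)
    \<le> 2 * int (card (edges (extremal_graph n \<delta> k)))"
proof -
  define p where "p = n + k - (2 * \<delta> + 3)"
  let ?H = "extremal_graph n \<delta> k"
  let ?V = "verts ?H" and ?S = "ext_hub \<delta>"
  let ?I = "(\<lambda>x. {x}) ` ext_iso (\<delta> - k)"
  let ?Q = "insert (ext_big p) (insert ext_tri ?I)"
  have V: "?V = ?S \<union> ext_big p \<union> ext_tri \<union> ext_iso (\<delta> - k)"
    unfolding p_def by (rule verts_extremal_graph)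
  have finV: "finite ?V" unfolding V by (simp add: finite_ext)
  have "card ?V = \<delta> + p + 3 + (\<delta> - k)"
    unfolding V by (simp add: card_Un_disjoint finite_ext card_ext disjoint_ext Int_Un_distrib2)
  then have cV: "card ?V = n" using assms unfolding p_def by simp
  have SV: "?S \<subseteq> ?V" unfolding V by blast
  have disj: "disjoint ?Q" using disjoint_ext(4)[of p] disjoint_ext(5)[of p "\<delta> - k"] disjoint_ext(6)[of "\<delta> - k"]
    by (auto simp: disjoint_def)
  have UQ: "\<Union>?Q = ?V - ?S" unfolding V
    using disjoint_ext(1)[of \<delta> p] disjoint_ext(2)[of \<delta>] disjoint_ext(3)[of \<delta> "\<delta> - k"] by auto
  \<comment> \<open>\<open>ext_big p\<close> may be empty, so the two parts are told apart by the
    vertices of the triangle.\<close>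
  have ne: "ext_big p \<noteq> ext_tri"
  proof
    assume "ext_big p = ext_tri"
    then have "ext_tri = {}" using disjoint_ext(4)[of p] by simp
    then show False using card_ext(3) by simp
  qed
  have nI: "ext_big p \<notin> ?I" "ext_tri \<notin> ?I" using disjoint_ext(5)[of p "\<delta> - k"] disjoint_ext(6)[of "\<delta> - k"] by auto
  have sumI: "(\<Sum>A\<in>?I. (int (card A))\<^sup>2) = int (\<delta> - k)"
    by (subst sum.reindex) (auto simp: card_ext)
  have "(\<Sum>A\<in>?Q. (int (card A))\<^sup>2) = (int p)\<^sup>2 + 9 + int (\<delta> - k)"
    using ne nI by (simp add: finite_ext sumI card_ext)
  moreover have "int p = int n + int k - 2 * int \<delta> - 3" "int (\<delta> - k) = int \<delta> - int k"
    using assms unfolding p_def by (simp_all add: of_nat_diff)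
  ultimately have c: "2 * int (card (cluster_edges ?V ?S ?Q)) =
    (int n)\<^sup>2 - int n - (int n - int \<delta>)\<^sup>2 + (int n + int k - 2 * int \<delta> - 3)\<^sup>2 + 9 + (int \<delta> - int k)"
    using card_cluster_edges[OF finV SV disj UQ] cV by (simp add: card_ext)
  have sub: "cluster_edges ?V ?S ?Q \<subseteq> edges ?H"
  proof
    fix e assume "e \<in> cluster_edges ?V ?S ?Q"
    then have e: "e \<subseteq> ?V" "card e = 2" "e \<inter> ?S \<noteq> {} \<or> (\<exists>A\<in>?Q. e \<subseteq> A)"
      unfolding cluster_edges_def by auto
    obtain x y where xy: "e = {x, y}" "x \<noteq> y" using e(2) by (auto simp: card_2_iff)
    then have "x \<in> ?S \<or> y \<in> ?S \<or> x \<in> ext_big p \<and> y \<in> ext_big p \<or> x \<in> ext_tri \<and> y \<in> ext_tri"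
      using e(3) by auto
    then show "e \<in> edges ?H"
      using edge_extremal_graph[of x n \<delta> k y] e(1) xy unfolding p_def by auto
  qed
  have "finite (edges ?H)"
  proof -
    have "edges ?H \<subseteq> Pow ?V"
      unfolding extremal_graph_def graph_join_def graph_union_def graph_copies_def complete_graph_def
      by auto
    then show ?thesis using finV finite_subset by blast
  qed
  then have "card (cluster_edges ?V ?S ?Q) \<le> card (edges ?H)" using sub by (intro card_mono)
  then show ?thesis using c by linarith
qed

text \<open>Adjacency depends only on the classes of the two vertices, so any bijections between
  classes of equal size glue to an isomorphism.\<close>

lemma graph_iso_extremal_graph:
  assumes fin: "finite (verts G)" and V: "verts G = S \<union> A \<union> B \<union> I"
    and disj: "S \<inter> A = {}" "S \<inter> B = {}" "S \<inter> I = {}" "A \<inter> B = {}" "A \<inter> I = {}" "B \<inter> I = {}"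
    and card: "card S = \<delta>" "card A = n + k - (2 * \<delta> + 3)" "card B = 3" "card I = \<delta> - k"
    and adj: "\<And>u v. u \<in> verts G \<Longrightarrow> v \<in> verts G \<Longrightarrow> {u, v} \<in> edges G \<longleftrightarrow>
      u \<noteq> v \<and> (u \<in> S \<or> v \<in> S \<or> u \<in> A \<and> v \<in> A \<or> u \<in> B \<and> v \<in> B)"
  shows "graph_iso G (extremal_graph n \<delta> k)"
proof -
  let ?p = "n + k - (2 * \<delta> + 3)"
  have fins: "finite S" "finite A" "finite B" "finite I" using fin unfolding V by auto
  obtain f1 f2 f3 f4 where
    f: "bij_betw f1 S (ext_hub \<delta>)" "bij_betw f2 A (ext_big ?p)" "bij_betw f3 B ext_tri"
      "bij_betw f4 I (ext_iso (\<delta> - k))"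
    using fins finite_ext card card_ext finite_same_card_bij by metis
  define g where "g x = (if x \<in> S then f1 x else if x \<in> A then f2 x else if x \<in> B then f3 x else f4 x)" for x
  have g1: "bij_betw g S (ext_hub \<delta>)"
    using f(1) by (rule bij_betw_cong[THEN iffD1, rotated]) (simp add: g_def)
  have g2: "bij_betw g A (ext_big ?p)"
    using f(2) by (rule bij_betw_cong[THEN iffD1, rotated]) (use disj in \<open>auto simp: g_def\<close>)
  have g3: "bij_betw g B ext_tri"
    using f(3) by (rule bij_betw_cong[THEN iffD1, rotated]) (use disj in \<open>auto simp: g_def\<close>)
  have g4: "bij_betw g I (ext_iso (\<delta> - k))"
    using f(4) by (rule bij_betw_cong[THEN iffD1, rotated]) (use disj in \<open>auto simp: g_def\<close>)
  have bij: "bij_betw g (verts G) (verts (extremal_graph n \<delta> k))"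
    unfolding V verts_extremal_graph
    by (intro bij_betw_combine g1 g2 g3 g4) (simp_all add: Int_Un_distrib2 disjoint_ext)
  have m: "x \<in> S \<Longrightarrow> g x \<in> ext_hub \<delta>" "x \<in> A \<Longrightarrow> g x \<in> ext_big ?p" "x \<in> B \<Longrightarrow> g x \<in> ext_tri"
    "x \<in> I \<Longrightarrow> g x \<in> ext_iso (\<delta> - k)" for x
    using g1 g2 g3 g4 by (auto dest: bij_betwE)
  have mem: "g x \<in> ext_hub \<delta> \<longleftrightarrow> x \<in> S" "g x \<in> ext_big ?p \<longleftrightarrow> x \<in> A" "g x \<in> ext_tri \<longleftrightarrow> x \<in> B"
    if "x \<in> verts G" for x
    using that m[of x] disj disjoint_ext(1)[of \<delta> ?p] disjoint_ext(2)[of \<delta>] disjoint_ext(3)[of \<delta> "\<delta> - k"]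
      disjoint_ext(4)[of ?p] disjoint_ext(5)[of ?p "\<delta> - k"] disjoint_ext(6)[of "\<delta> - k"]
    unfolding V disjoint_iff by (elim UnE; metis)+
  have "{u, v} \<in> edges G \<longleftrightarrow> {g u, g v} \<in> edges (extremal_graph n \<delta> k)"
    if uv: "u \<in> verts G" "v \<in> verts G" for u v
  proof -
    have "g u \<in> verts (extremal_graph n \<delta> k)" "g v \<in> verts (extremal_graph n \<delta> k)"
      using bij uv by (auto dest: bij_betwE)
    moreover have "g u = g v \<longleftrightarrow> u = v" using bij uv by (auto simp: bij_betw_def inj_on_def)
    ultimately show ?thesis using adj[OF uv] edge_extremal_graph mem uv by simp
  qed
  then show ?thesis unfolding graph_iso_def using bij by blast
qed

subsection \<open>Proof of the theorem\<close>

text \<open>If a vertex \<open>v\<close> had at most \<open>k\<close> neighbours, a set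
  \<open>X\<close> of \<open>k\<close> vertices containing them but not \<open>v\<close> could be
  deleted; \<open>v\<close> would be isolated and no fractional perfect matching could cover
  it.\<close>

lemma fractional_factor_critical_min_degree:
  assumes G: "simple_graph G" and frac: "fractional_factor_critical k G" and k: "k < card (verts G)"
  shows "k < min_degree G"
proof (rule ccontr)
  assume "\<not> k < min_degree G"
  moreover have "verts G \<noteq> {}" using k by auto
  ultimately obtain v where v: "v \<in> verts G" "degree G v \<le> k"
    using min_degree_attained[OF G] by (metis not_less)
  let ?N = "{u. {v, u} \<in> edges G}"
  have finV: "finite (verts G)" using simple_graph_finite[OF G] by blast
  have N: "?N \<subseteq> verts G - {v}" "card ?N \<le> k"
    using neighbours_subset[OF G] v(2) degree_eq_card_neighbours[OF G] by auto
  have "k \<le> card (verts G - {v})" using k v finV by simp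
  then obtain X where X: "?N \<subseteq> X" "X \<subseteq> verts G - {v}" "card X = k"
    using exists_subset_between[of ?N k "verts G - {v}"] N finV by auto
  then obtain h where h: "fractional_perfect_matching (delete_verts G X) h"
    using frac unfolding fractional_factor_critical_def by blast
  have "card {v} \<le> card ({} :: 'a set)"
  proof (rule fractional_perfect_matching_isolated[OF simple_graph_delete_verts[OF G] h])
    have "e \<subseteq> {v}" if ev: "e \<in> edges (delete_verts G X)" "v \<in> e" for e
    proof -
      have e: "e \<in> edges G" "e \<inter> X = {}" using ev unfolding delete_verts_def by auto
      obtain u where "e = {v, u}" using simple_graphD(2)[OF G e(1)] ev(2) by (auto simp: card_2_iff)
      then show ?thesis using e X(1) by auto
    qed
    moreover have "v \<in> verts (delete_verts G X)" using v X(2) unfolding delete_verts_def by auto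
    ultimately show "{v} \<subseteq> verts (delete_verts G X) - {}"
      "\<And>w. w \<in> {v} \<Longrightarrow> closed_in (edges (delete_verts G X)) (verts (delete_verts G X) - {}) {w}"
      unfolding closed_in_def by auto
  qed simp
  then show False by simp
qed

theorem theorem1p3:
  fixes G :: "'a graph" and k n \<delta> :: nat
  assumes "simple_graph G"
    and "k \<ge> 1"
    and "n = graph_order G"
    and "\<delta> = min_degree G"
    and "t_connected (k + 1) G"
    and "fractional_factor_critical k G"
    and "[n = k] (mod 2)"
    and "real n \<ge> max (6 * real \<delta> - 5 * real k + 8)
           ((real \<delta>)\<^sup>2 / 6 - (real k / 3 - 3 / 2) * real \<delta> + (real k)\<^sup>2 / 6 - real k / 2 + 4)"
    and "card (edges G) \<ge> card (edges (extremal_graph n \<delta> k))"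
  shows "\<not> graph_iso G (extremal_graph n \<delta> k) \<longrightarrow> factor_critical k G"
proof (rule impI, rule ccontr)
  assume niso: "\<not> graph_iso G (extremal_graph n \<delta> k)" and nfc: "\<not> factor_critical k G"
  note G = assms(1)
  have finV: "finite (verts G)" using simple_graph_finite[OF G] by blast
  have n: "n = card (verts G)" using assms(3) unfolding graph_order_def .
  have par: "even (card (verts G) + k)"
    using assms(7) unfolding n[symmetric] cong_def by presburger
  have kn: "k + 1 < n" using assms(3,5) unfolding t_connected_def by simp
  have k\<delta>: "k < \<delta>"
    using fractional_factor_critical_min_degree[OF G assms(6)] kn n assms(4) by simp
  obtain S Q where S: "S \<subseteq> verts G" "k < card S" and disjQ: "disjoint Q" and UQ: "\<Union>Q = verts G - S"
    and cQ: "card Q + k = card S + 2" and oddQ: "\<And>A. A \<in> Q \<Longrightarrow> odd (card A)"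
    and sub: "edges G \<subseteq> cluster_edges (verts G) S Q"
    and singles: "card {A \<in> Q. card A = 1} + k \<le> card S"
    using not_factor_critical_obtains[OF G assms(5,6) par nfc] by blast
  have finS: "finite S" using S finV finite_subset by blast
  have finQ: "finite Q" using UQ finV by (metis finite_Diff finite_UnionD)
  have finA: "finite A" if "A \<in> Q" for A using that UQ finV by (metis Union_upper finite_Diff finite_subset)
  have neA: "A \<noteq> {}" if "A \<in> Q" for A using oddQ[OF that] by auto
  have sameQ: "A = B" if "A \<in> Q" "B \<in> Q" "x \<in> A" "x \<in> B" for A B x
    using disjQ that by (auto simp: disjoint_def)
  let ?C = "cluster_edges (verts G) S Q"
  have finC: "finite ?C"
    by (rule finite_subset[of _ "Pow (verts G)"]) (auto simp: cluster_edges_def finV)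
  \<comment> \<open>A vertex of \<open>A\<close> has all its neighbours in \<open>S\<close> or among
    the other vertices of \<open>A\<close>.\<close>
  have deg: "\<delta> + 1 \<le> card S + card A" if A: "A \<in> Q" for A
  proof -
    obtain x where x: "x \<in> A" using neA[OF A] by blast
    have xV: "x \<in> verts G" "x \<notin> S" using x A UQ by auto
    have "{u. {x, u} \<in> edges G} \<subseteq> S \<union> A - {x}"
    proof
      fix u assume u: "u \<in> {u. {x, u} \<in> edges G}"
      then have "{x, u} \<in> ?C" using sub by blast
      then have "u \<in> S \<or> (\<exists>B\<in>Q. x \<in> B \<and> u \<in> B)" using xV(2) unfolding cluster_edges_def by auto
      then have "u \<in> S \<or> u \<in> A" using sameQ[OF A _ x] by blast
      then show "u \<in> S \<union> A - {x}" using neighbours_subset[OF G, of x] u by blast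
    qed
    then have "degree G x \<le> card (S \<union> A - {x})"
      unfolding degree_eq_card_neighbours[OF G] using finS finA[OF A] by (intro card_mono) auto
    also have "\<dots> < card (S \<union> A)" using x finS finA[OF A] by (intro psubset_card_mono) auto
    also have "\<dots> \<le> card S + card A" by (rule card_Un_le)
    finally show ?thesis using min_degree_le[OF G xV(1)] assms(4) by simp
  qed
  have sumQ: "(\<Sum>A\<in>Q. int (card A)) = int n - int (card S)"
  proof -
    have "card (\<Union>Q) = (\<Sum>A\<in>Q. card A)" using disjQ finA by (intro card_Union_disjoint) auto
    moreover have "card (verts G - S) = n - card S" using S finS n by (simp add: card_Diff_subset)
    moreover have "card S \<le> n" using S(1) finV n by (simp add: card_mono)
    ultimately show ?thesis using UQ by (simp flip: of_nat_sum add: of_nat_diff)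
  qed
  \<comment> \<open>Subtracting \<open>k\<close> removes it from the estimates:
    \<open>6 * \<delta> - 5 * k + 8 \<le> n\<close> becomes \<open>6 * d + 8 \<le> N\<close>, and
    there are \<open>t + 2\<close> parts.\<close>
  define N t d where "N = int n - int k" and "t = int (card S) - int k" and "d = int \<delta> - int k"
  have cQ': "int (card Q) = t + 2" using cQ unfolding t_def by linarith
  have t1: "1 \<le> t" using S(2) unfolding t_def by linarith
  have "6 * real \<delta> - 5 * real k + 8 \<le> real n" using assms(8) by simp
  then have "6 * int \<delta> - 5 * int k + 8 \<le> int n" by linarith
  then have Nd: "6 * d + 8 \<le> N" unfolding N_def d_def by (simp add: algebra_simps)
  have sum': "(\<Sum>A\<in>Q. int (card A)) = N - t" using sumQ unfolding N_def t_def by simp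
  have "2 * int (card ?C) = (int n)\<^sup>2 - int n - (N - t)\<^sup>2 + (\<Sum>A\<in>Q. (int (card A))\<^sup>2)"
    using card_cluster_edges[OF finV S(1) disjQ UQ] n unfolding N_def t_def by simp
  moreover have "(int n)\<^sup>2 - int n - (N - d)\<^sup>2 + (N - 2 * d - 3)\<^sup>2 + 9 + d
      \<le> 2 * int (card (edges (extremal_graph n \<delta> k)))"
  proof -
    have "0 \<le> d" using k\<delta> unfolding d_def by simp
    then have "2 * d + 3 \<le> N" using Nd by linarith
    then have "k \<le> \<delta>" "2 * \<delta> + 3 \<le> n + k"
      using k\<delta> unfolding N_def d_def by (simp_all add: algebra_simps)
    note card_edges_extremal_graph_ge[OF this]
    moreover have "int n - int \<delta> = N - d" "int n + int k - 2 * int \<delta> - 3 = N - 2 * d - 3" "int \<delta> - int k = d"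
      unfolding N_def d_def by simp_all
    ultimately show ?thesis by simp
  qed
  moreover have "card (edges G) \<le> card ?C" using finC sub by (rule card_mono)
  \<comment> \<open>\<open>card (edges G)\<close> lies between the size of the extremal graph and
    \<open>card ?C\<close>. This yields \<open>lower\<close>; if the barrier bound is also at most
    the extremal one, the three numbers coincide, which yields \<open>tight\<close>.\<close>
  ultimately have lower: "- (N - d)\<^sup>2 + (N - 2 * d - 3)\<^sup>2 + 9 + d \<le> - (N - t)\<^sup>2 + (\<Sum>A\<in>Q. (int (card A))\<^sup>2)"
    and tight: "- (N - t)\<^sup>2 + (\<Sum>A\<in>Q. (int (card A))\<^sup>2) \<le> - (N - d)\<^sup>2 + (N - 2 * d - 3)\<^sup>2 + 9 + d
      \<Longrightarrow> card (edges G) = card ?C"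
    using assms(9) by linarith+
  show False
  proof (cases "t < d")

    \<comment> \<open>Small barriers, \<open>t < d\<close>: too few edges\<close>
    case True
    \<comment> \<open>Minimum degree gives parts of size at least \<open>d - t + 1 \<ge> 2\<close>,
      and oddness raises 2 to 3. \<open>B\<close> is the surplus over \<open>m\<close> in all parts
      together.\<close>
    define m where "m = max 3 (d - t + 1)"
    define B where "B = N - t - m * int (card Q)"
    have mA: "m \<le> int (card A)" if A: "A \<in> Q" for A
    proof -
      have "d - t + 1 \<le> int (card A)" using deg[OF A] unfolding d_def t_def by linarith
      moreover have "3 \<le> card A"
      proof -
        have "2 \<le> card A" using calculation True by linarith
        moreover have "card A \<noteq> 2" using oddQ[OF A] by auto
        ultimately show ?thesis by linarith
      qed
      ultimately show ?thesis unfolding m_def by simp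
    qed
    have "int (card Q) * m \<le> (\<Sum>A\<in>Q. int (card A))" using sum_bounded_below[of Q m "\<lambda>A. int (card A)"] mA by simp
    then have B: "0 \<le> B" unfolding B_def sum' by (simp add: mult.commute)
    have "(\<Sum>A\<in>Q. (int (card A))\<^sup>2) \<le> int (card Q) * m\<^sup>2 + 2 * m * B + B\<^sup>2"
      using mA sum' by (intro sum_squares_le_concentrated finQ) (auto simp: B_def)
    moreover have "- (N - t)\<^sup>2 + (t + 2) * m\<^sup>2 + 2 * m * B + B\<^sup>2 < - (N - d)\<^sup>2 + (N - 2 * d - 3)\<^sup>2 + 9 + d"
    proof (rule small_barrier_bound[OF t1 _ B])
      \<comment> \<open>The maximum exceeds \<open>d - t + 1\<close> only for
        \<open>d = t + 1\<close>, where oddness replaces 2 by 3.\<close>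
      show "d = t + 1 \<and> m = 3 \<or> d = t + m - 1" using True unfolding m_def by linarith
      show "N = B + t + (t + 2) * m" unfolding B_def cQ' by (simp add: mult.commute)
    qed (simp add: m_def)
    ultimately show False using lower cQ' by simp
  next

    \<comment> \<open>Large barriers, \<open>d \<le> t\<close>: equality and the extremal
      structure\<close>
    case False
    \<comment> \<open>Of the \<open>t + 2\<close> parts at most \<open>t\<close> are singletons, so
      two parts have at least three vertices.\<close>
    have "{A \<in> Q. card A \<noteq> 1} = Q - {A \<in> Q. card A = 1}" by blast
    then have "card {A \<in> Q. card A \<noteq> 1} = card Q - card {A \<in> Q. card A = 1}"
      using finQ by (simp add: card_Diff_subset)
    then have "2 \<le> card {A \<in> Q. card A \<noteq> 1}" using singles cQ by linarith
    then obtain P where "P \<subseteq> {A \<in> Q. card A \<noteq> 1}" "card P = 2" by (meson obtain_subset_with_card_n)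
    then obtain A B where AB: "A \<in> Q" "B \<in> Q" "A \<noteq> B" "card A \<noteq> 1" "card B \<noteq> 1"
      by (auto simp: card_2_iff)
    have ge3: "3 \<le> card D" if "D \<in> Q" "card D \<noteq> 1" for D
      using oddQ[OF that(1)] that(2) by presburger
    define R where "R = Q - {A, B}"
    \<comment> \<open>\<open>x\<close> and \<open>y\<close> are the surpluses of the two chosen
      parts over 3; below, \<open>c\<close> is the surplus of the other \<open>t\<close> parts over
      1 each.\<close>
    define x y where "x = int (card A) - 3" and "y = int (card B) - 3"
    have xy: "0 \<le> x" "0 \<le> y" using ge3 AB unfolding x_def y_def by force+
    have split: "(\<Sum>D\<in>Q. f D) = f A + f B + (\<Sum>D\<in>R. f D)" for f :: "'a set \<Rightarrow> int"
    proof -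
      have "Q = insert A (insert B R)" "A \<notin> insert B R" "B \<notin> R" "finite R"
        unfolding R_def using AB finQ by auto
      then show ?thesis by simp
    qed
    have cR: "int (card R) = t"
    proof -
      have "card R = card Q - 2" unfolding R_def using AB finQ by (simp add: card_Diff_subset)
      then show ?thesis using cQ' t1 by linarith
    qed
    have finR: "finite R" unfolding R_def using finQ by simp
    have R1: "1 \<le> int (card D)" if "D \<in> R" for D
      using oddQ[of D] that unfolding R_def by (cases "card D") auto
    define c where "c = (\<Sum>D\<in>R. int (card D)) - t"
    have c: "c = (\<Sum>D\<in>R. int (card D) - 1)" unfolding c_def using cR by (simp add: sum_subtractf)
    have c0: "0 \<le> c" unfolding c using R1 by (intro sum_nonneg) force
    have sumR: "(\<Sum>D\<in>R. (int (card D))\<^sup>2) \<le> t + 2 * c + c\<^sup>2"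
      using sum_squares_le_concentrated[OF finR, of 1 "\<lambda>D. int (card D)" c] R1 cR unfolding c_def by simp
    have total: "N = 2 * t + 6 + x + y + c"
      using sum' split[of "\<lambda>D. int (card D)"] unfolding x_def y_def c_def by linarith
    \<comment> \<open>The last bracket on the left is the exact gain in the sum of squares from
      moving the surpluses \<open>x\<close>, \<open>y\<close> and \<open>c\<close> into a single
      part of size \<open>N - 2 * t - 3\<close>.\<close>
    have sq: "(int (card A))\<^sup>2 + (int (card B))\<^sup>2 + (t + 2 * c + c\<^sup>2) + (4 * c + 2 * (x * y) + 2 * (c * (x + y)))
        = (N - 2 * t - 3)\<^sup>2 + 9 + t"
    proof -
      have "int (card A) = 3 + x" "int (card B) = 3 + y" unfolding x_def y_def by simp_all
      then show ?thesis unfolding total by (simp add: power2_eq_square algebra_simps)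
    qed
    have nonneg: "0 \<le> x * y" "0 \<le> c * (x + y)" using xy c0 by simp_all
    have upper: "- (N - t)\<^sup>2 + (N - 2 * t - 3)\<^sup>2 + t \<le> - (N - d)\<^sup>2 + (N - 2 * d - 3)\<^sup>2 + d"
      using False total xy c0 Nd by (intro large_barrier_bound) auto
    \<comment> \<open>\<open>upper\<close> closes the chain begun by \<open>lower\<close>, so
      everything is an equality: all permitted edges are present, and the nonnegative gain in
      \<open>sq\<close> vanishes, whence \<open>c = 0\<close> and \<open>x * y = 0\<close>.\<close>
    have "card (edges G) = card ?C"
      using tight split[of "\<lambda>D. (int (card D))\<^sup>2"] sumR sq nonneg c0 upper by linarith
    then have EC: "edges G = ?C" using sub finC by (metis card_subset_eq)
    have c_eq: "c = 0" and xy0: "x * y = 0"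
      using lower split[of "\<lambda>D. (int (card D))\<^sup>2"] sumR sq nonneg c0 upper by linarith+
    have sD: "card D = 1" if "D \<in> R" for D
    proof -
      have "\<forall>D\<in>R. int (card D) - 1 = 0"
        using c c_eq R1 by (subst sum_nonneg_eq_0_iff[OF finR, symmetric]) force+
      then show ?thesis using that by auto
    qed
    \<comment> \<open>Equality of the bounds can also occur for \<open>t > d\<close>, so the degree
      is used: with all permitted edges present every vertex has at least \<open>card S\<close>
      neighbours, hence \<open>card S \<le> \<delta>\<close>.\<close>
    have td: "t = d"
    proof -
      have "verts G \<noteq> {}" using kn n by auto
      then obtain v where v: "v \<in> verts G" "degree G v = \<delta>" using min_degree_attained[OF G] assms(4) by blast
      obtain a where a: "a \<in> A" using neA[OF AB(1)] by blast
      have aV: "a \<in> verts G" "a \<notin> S" using a AB(1) UQ by auto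
      have "\<exists>W. card W = card S \<and> W \<subseteq> {u. {v, u} \<in> edges G}"
      proof (cases "v \<in> S")
        case True
        \<comment> \<open>A vertex of \<open>S\<close> is not its own neighbour, so \<open>a\<close>
          from outside \<open>S\<close> makes up for it.\<close>
        have "card (insert a (S - {v})) = card S"
          using True finS aV(2) S(2) by simp
        moreover have "insert a (S - {v}) \<subseteq> {u. {v, u} \<in> edges G}"
          unfolding EC cluster_edges_def using True aV S(1) v(1) by (auto simp: card_insert_if)
        ultimately show ?thesis by blast
      next
        case False
        then have "S \<subseteq> {u. {v, u} \<in> edges G}"
          unfolding EC cluster_edges_def using S(1) v(1) by (auto simp: card_insert_if)
        then show ?thesis by blast
      qed
      then have "card S \<le> \<delta>"
        using v(2) degree_eq_card_neighbours[OF G, of v] neighbours_subset[OF G, of v] finV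
        by (metis card_mono finite_Diff finite_subset)
      then show ?thesis using False unfolding t_def d_def by linarith
    qed
    \<comment> \<open>Stated for arbitrary \<open>A\<close> and \<open>B\<close> because either
      chosen part may be the triangle: \<open>x * y = 0\<close> leaves open which surplus
      vanishes.\<close>
    have iso: "graph_iso G (extremal_graph n \<delta> k)"
      if Q3: "Q = insert A (insert B R)" "A \<noteq> B" "A \<notin> R" "B \<notin> R" and B3: "card B = 3"
        and A3: "int (card A) = N - 2 * t - 3" for A B
    proof (rule graph_iso_extremal_graph[where S = S and A = A and B = B and I = "\<Union>R", OF finV])
      have ABQ: "A \<in> Q" "B \<in> Q" using Q3 by auto
      show "verts G = S \<union> A \<union> B \<union> \<Union>R" using UQ S(1) Q3(1) by auto
      show "S \<inter> A = {}" "S \<inter> B = {}" "S \<inter> \<Union>R = {}" using UQ Q3(1) by auto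
      show "A \<inter> B = {}" using sameQ[OF ABQ] Q3(2) by blast
      show "A \<inter> \<Union>R = {}" "B \<inter> \<Union>R = {}" using sameQ ABQ Q3(1,3,4) by blast+
      show "card S = \<delta>" using td unfolding t_def d_def by linarith
      show "card A = n + k - (2 * \<delta> + 3)" using A3 td unfolding N_def d_def by linarith
      show "card B = 3" by (rule B3)
      have "card (\<Union>R) = (\<Sum>D\<in>R. card D)"
        using disjQ finA unfolding R_def by (intro card_Union_disjoint) (auto simp: disjoint_def pairwise_def)
      then have "card (\<Union>R) = card R" using sD by simp
      then show "card (\<Union>R) = \<delta> - k" using cR td unfolding d_def by linarith
      fix u v assume uv: "u \<in> verts G" "v \<in> verts G"
      have "{u, v} \<subseteq> D \<Longrightarrow> u = v" if "D \<in> R" for D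
        using sD[OF that] by (auto simp: card_1_singleton_iff)
      then have "u \<noteq> v \<Longrightarrow> (\<exists>D\<in>Q. {u, v} \<subseteq> D) \<longleftrightarrow> u \<in> A \<and> v \<in> A \<or> u \<in> B \<and> v \<in> B"
        unfolding Q3(1) by auto
      then show "{u, v} \<in> edges G \<longleftrightarrow> u \<noteq> v \<and> (u \<in> S \<or> v \<in> S \<or> u \<in> A \<and> v \<in> A \<or> u \<in> B \<and> v \<in> B)"
        unfolding EC cluster_edges_def using uv by (cases "u = v") auto
    qed
    have "x = 0 \<or> y = 0" using xy0 by simp
    then show False
    proof
      assume "y = 0"
      then show False using iso[of A B] niso AB total c_eq unfolding x_def y_def R_def by force
    next
      assume "x = 0"
      then show False using iso[of B A] niso AB total c_eq unfolding x_def y_def R_def by force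
    qed
  qed
qed

end
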